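(* Let $p=3$ and let $n$ be a positive integer with $3\mid n$. Let $a_1,\dots,a_n\in\mathbf{F}_3$ with $\sum_{i=1}^na_i=0$. Then one can take, as an element killed by all Dunkl operators $D_1,\dots,D_n$ with leading term $F_0=\sum_ia_ix_i^3$ (and hence as an element of degree $3$ of $J_c$), $$F=\sum_{i}a_ix_i^3-c\sum_{i,j}(a_i-a_j)x_i^2x_j+c^2\left(\sum_{i<j<k}(a_i+a_j+a_k)x_ix_jx_k+\sum_{i,j}(a_i-a_j)x_i^2x_j-\sum_ia_ix_i^3\right);$$ that is, $D_kF=0$ for all $k=1,\dots,n$. Here $\sum_{i,j}$ runs over all ordered pairs $(i,j)$ of indices in $\{1,\dots,n\}$.
   Context: $c$ is an indeterminate (generic parameter) and the ground field is $K=\mathbf{F}_p(c)$ with $p=3$. The Dunkl operators on $K[x_1,\dots,x_n]$ are $D_k=\frac{\partial}{\partial x_k}-c\sum_{j\neq k}\frac{1}{x_k-x_j}(1-s_{kj})$, where $s_{kj}$ is the transposition swapping $x_k$ and $x_j$. The rational Cherednik algebra of $S_n$ (permutation representation) acts on $M_c=K[x_1,\dots,x_n]$ (the Verma module of the trivial representation) by multiplication by the $x_k$, permutations, and the $D_k$. $J_c$ is the unique maximal proper graded submodule of $M_c$, i.e. the largest proper homogeneous ideal stable under $S_n$ and all $D_k$; a homogeneous polynomial of positive degree killed by all $D_k$ lies in $J_c$. Writing $F=F_0+cF_1+c^2F_2+\cdots$ with $F_m\in\mathbf{F}_p[x_1,\dots,x_n]$, the leading term is $F_0$. *)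

theory Defs
  imports
    "HOL-Library.Cardinality"
    "HOL-Library.Poly_Mapping"
    "HOL-Combinatorics.Transposition"
    "HOL-Computational_Algebra.Fraction_Field"
    "HOL-Computational_Algebra.Polynomial_FPS"
begin

section \<open>The ground field\<close>

text \<open>
  The library type \<open>Enum.finite_3\<close> is an instance of class \<open>field\<close>; having three elements,
  it is the prime field with three elements.
\<close>

type_synonym F3 = Enum.finite_3

lemma card_F3: "CARD(F3) = 3"
  by (simp add: UNIV_finite_3)

type_synonym F3c = "F3 poly fract"

abbreviation c_param :: F3c
  where "c_param \<equiv> Fraction_Field.Fract [:0, 1:] 1"

abbreviation of_F3 :: "F3 \<Rightarrow> F3c"
  where "of_F3 u \<equiv> Fraction_Field.Fract [:u:] 1"


section \<open>Polynomials in finitely many variables\<close>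

text \<open>
  For a finite type \<open>'v\<close> with \<open>n\<close> elements, \<open>('v, 'k) mpol\<close> is the polynomial ring over
  \<open>'k\<close> in \<open>n\<close> variables indexed by \<open>'v\<close>: finitely supported functions from exponent
  vectors to coefficients, with convolution as multiplication.
\<close>

type_synonym ('v, 'k) mpol = "('v \<Rightarrow>\<^sub>0 nat) \<Rightarrow>\<^sub>0 'k"

definition Const :: "'k \<Rightarrow> ('v, 'k::zero) mpol"
  where "Const a = Poly_Mapping.single 0 a"

definition Var :: "'v \<Rightarrow> ('v, 'k::zero_neq_one) mpol"
  where "Var i = Poly_Mapping.single (Poly_Mapping.single i 1) 1"

definition mdeg :: "('v::finite \<Rightarrow>\<^sub>0 nat) \<Rightarrow> nat"
  where "mdeg m = (\<Sum>i\<in>UNIV. Poly_Mapping.lookup m i)"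

definition homogeneous :: "nat \<Rightarrow> ('v::finite, 'k::zero) mpol \<Rightarrow> bool"
  where "homogeneous d f \<longleftrightarrow> (\<forall>m\<in>Poly_Mapping.keys f. mdeg m = d)"

definition hom_component ::
    "nat \<Rightarrow> ('v::finite, 'k::comm_monoid_add) mpol \<Rightarrow> ('v, 'k) mpol"
  where "hom_component d f =
    (\<Sum>m | m \<in> Poly_Mapping.keys f \<and> mdeg m = d. Poly_Mapping.single m (Poly_Mapping.lookup f m))"

text \<open>The substitution \<open>x\<^sub>i \<mapsto> x\<^bsub>\<sigma> i\<^esub>\<close>.\<close>

definition perm_act :: "('v \<Rightarrow> 'v) \<Rightarrow> ('v::finite, 'k::comm_ring_1) mpol \<Rightarrow> ('v, 'k) mpol"
  where "perm_act \<sigma> f =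
    (\<Sum>m\<in>Poly_Mapping.keys f.
       Const (Poly_Mapping.lookup f m) * (\<Prod>i\<in>UNIV. Var (\<sigma> i) ^ Poly_Mapping.lookup m i))"

text \<open>
  In the monomial below the subtraction truncates only when the exponent of \<open>x\<^sub>k\<close> is \<open>0\<close>, in
  which case the coefficient vanishes.
\<close>

definition partial :: "'v \<Rightarrow> ('v, 'k::comm_ring_1) mpol \<Rightarrow> ('v, 'k) mpol"
  where "partial k f =
    (\<Sum>m\<in>Poly_Mapping.keys f.
       Poly_Mapping.single (m - Poly_Mapping.single k 1)
         (of_nat (Poly_Mapping.lookup m k) * Poly_Mapping.lookup f m))"


section \<open>Dunkl operators\<close>

text \<open>
  The polynomial \<open>(f - s\<^sub>k\<^sub>j f) / (x\<^sub>k - x\<^sub>j)\<close>; for \<open>k \<noteq> j\<close> the division is exact, see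
  \<open>divided_difference_eq\<close> below.
\<close>

definition divided_difference ::
    "'v \<Rightarrow> 'v \<Rightarrow> ('v::finite, 'k::comm_ring_1) mpol \<Rightarrow> ('v, 'k) mpol"
  where "divided_difference k j f =
    (THE g. (Var k - Var j) * g = f - perm_act (transpose k j) f)"

definition dunkl :: "'k \<Rightarrow> 'v \<Rightarrow> ('v::finite, 'k::comm_ring_1) mpol \<Rightarrow> ('v, 'k) mpol"
  where "dunkl c k f =
    partial k f - Const c * (\<Sum>j\<in>UNIV - {k}. divided_difference k j f)"


section \<open>The maximal proper graded submodule of the Verma module\<close>

text \<open>
  The rational Cherednik algebra is generated by the variables, the permutations and the
  Dunkl operators, so its submodules of the polynomial ring are the ideals stable under the
  last two.
\<close>

definition graded_submodule :: "'k \<Rightarrow> ('v::finite, 'k::comm_ring_1) mpol set \<Rightarrow> bool"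
  where "graded_submodule c I \<longleftrightarrow>
    0 \<in> I \<and>
    (\<forall>f\<in>I. \<forall>g\<in>I. f + g \<in> I) \<and>
    (\<forall>f\<in>I. \<forall>g. g * f \<in> I) \<and>
    (\<forall>f\<in>I. \<forall>\<sigma>. bij \<sigma> \<longrightarrow> perm_act \<sigma> f \<in> I) \<and>
    (\<forall>f\<in>I. \<forall>k. dunkl c k f \<in> I) \<and>
    (\<forall>f\<in>I. \<forall>d. hom_component d f \<in> I)"

text \<open>That the greatest such set exists is \<open>maximal_submodule_greatest\<close> below.\<close>

definition maximal_submodule :: "'k \<Rightarrow> ('v::finite, 'k::comm_ring_1) mpol set"
  where "maximal_submodule c = (GREATEST I. graded_submodule c I \<and> I \<noteq> UNIV)"


section \<open>Leading terms\<close>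

text \<open>
  \<open>c_expansion F Fs\<close> says that \<open>F = Fs 0 + c Fs 1 + c\<^sup>2 Fs 2 + \<dots>\<close>: every coefficient of \<open>F\<close> is
  a fraction \<open>q / r\<close> of polynomials in \<open>c\<close> whose power series at \<open>c = 0\<close> has as its
  \<open>l\<close>-th coefficient the corresponding coefficient of \<open>Fs l\<close>.
\<close>

definition c_expansion :: "('v, F3c) mpol \<Rightarrow> (nat \<Rightarrow> ('v, F3) mpol) \<Rightarrow> bool"
  where "c_expansion F Fs \<longleftrightarrow>
    (\<forall>m. \<exists>q r. r \<noteq> 0 \<and> Poly_Mapping.lookup F m = Fraction_Field.Fract q r \<and>
       fps_of_poly q = fps_of_poly r * Abs_fps (\<lambda>l. Poly_Mapping.lookup (Fs l) m))"

definition has_leading_term :: "('v, F3c) mpol \<Rightarrow> ('v, F3) mpol \<Rightarrow> bool"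
  where "has_leading_term F F0 \<longleftrightarrow> (\<exists>Fs. c_expansion F Fs \<and> Fs 0 = F0)"


section \<open>Well-definedness\<close>

lemma sum_keys_superset:
  assumes "finite A" "Poly_Mapping.keys f \<subseteq> A" "\<And>m. h m 0 = 0"
  shows "(\<Sum>m\<in>Poly_Mapping.keys f. h m (Poly_Mapping.lookup f m)) = (\<Sum>m\<in>A. h m (Poly_Mapping.lookup f m))"
  using assms by (intro sum.mono_neutral_left) (auto simp: in_keys_iff)

lemma sum_keys_add:
  fixes h :: "'m \<Rightarrow> 'k::comm_monoid_add \<Rightarrow> 'b::comm_monoid_add"
  assumes z: "\<And>m. h m 0 = 0" and a: "\<And>m x y. h m (x + y) = h m x + h m y"
  shows "(\<Sum>m\<in>Poly_Mapping.keys (f + g). h m (Poly_Mapping.lookup (f + g) m)) =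
    (\<Sum>m\<in>Poly_Mapping.keys f. h m (Poly_Mapping.lookup f m)) +
    (\<Sum>m\<in>Poly_Mapping.keys g. h m (Poly_Mapping.lookup g m))"
proof -
  let ?A = "Poly_Mapping.keys f \<union> Poly_Mapping.keys g"
  have "finite ?A" by simp
  then show ?thesis
    using sum_keys_superset[of ?A "f + g" h] sum_keys_superset[of ?A f h]
      sum_keys_superset[of ?A g h] z Poly_Mapping.keys_add[of f g]
    by (simp add: lookup_add a sum.distrib)
qed

lemma Const_0: "Const 0 = 0"
  by (simp add: Const_def)

lemma Const_add: "Const (a + b) = Const a + Const b"
  by (simp add: Const_def single_add)

lemma perm_act_add: "perm_act \<sigma> (f + g) = perm_act \<sigma> f + perm_act \<sigma> g"
  unfolding perm_act_def
  by (rule sum_keys_add[where h = "\<lambda>m x. Const x * (\<Prod>i\<in>UNIV. Var (\<sigma> i) ^ Poly_Mapping.lookup m i)"])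
    (simp_all add: Const_0 Const_add algebra_simps)

lemma partial_add: "partial k (f + g) = partial k f + partial k g"
  unfolding partial_def
  by (rule sum_keys_add[where h = "\<lambda>m x. Poly_Mapping.single (m - Poly_Mapping.single k 1)
         (of_nat (Poly_Mapping.lookup m k) * x)"])
    (simp_all add: single_add algebra_simps)

lemma hom_component_add: "hom_component d (f + g) = hom_component d f + hom_component d g"
proof -
  have *: "hom_component d f = (\<Sum>m\<in>Poly_Mapping.keys f.
      if mdeg m = d then Poly_Mapping.single m (Poly_Mapping.lookup f m) else 0)"
    for f :: "('a, 'b) mpol"
    unfolding hom_component_def by (rule sum.mono_neutral_cong_left) auto
  show ?thesis
    unfolding *
    by (rule sum_keys_add[where h = "\<lambda>m x. if mdeg m = d then Poly_Mapping.single m x else 0"])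
      (simp_all add: single_add)
qed

lemma Var_power: "(Var i :: ('v, 'k::comm_ring_1) mpol) ^ e = Poly_Mapping.single (Poly_Mapping.single i e) 1"
  by (induction e) (simp_all add: Var_def mult_single single_add[symmetric])

lemma prod_Var_power:
  fixes e :: "'v::finite \<Rightarrow> nat"
  assumes "finite A"
  shows "(\<Prod>i\<in>A. (Var i :: ('v, 'k::comm_ring_1) mpol) ^ e i) =
    Poly_Mapping.single (\<Sum>i\<in>A. Poly_Mapping.single i (e i)) 1"
  using assms by (induction A) (simp_all add: Var_power mult_single)

lemma sum_single_lookup:
  fixes f :: "'m \<Rightarrow>\<^sub>0 'b::comm_monoid_add"
  assumes "finite A" "Poly_Mapping.keys f \<subseteq> A"
  shows "(\<Sum>i\<in>A. Poly_Mapping.single i (Poly_Mapping.lookup f i)) = f"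
proof (rule poly_mapping_eqI)
  fix k
  show "Poly_Mapping.lookup (\<Sum>i\<in>A. Poly_Mapping.single i (Poly_Mapping.lookup f i)) k = Poly_Mapping.lookup f k"
    using assms
    by (auto simp: Poly_Mapping.lookup_sum lookup_single when_def in_keys_iff)
qed

lemma mpol_expand:
  fixes f :: "('v::finite, 'k::comm_ring_1) mpol"
  shows "f = (\<Sum>m\<in>Poly_Mapping.keys f.
       Const (Poly_Mapping.lookup f m) * (\<Prod>i\<in>UNIV. Var i ^ Poly_Mapping.lookup m i))"
proof -
  have "(\<Sum>i\<in>UNIV. Poly_Mapping.single i (Poly_Mapping.lookup m i)) = m" for m :: "'v \<Rightarrow>\<^sub>0 nat"
    by (rule sum_single_lookup) auto
  then show ?thesis
    by (simp add: prod_Var_power Const_def mult_single sum_single_lookup)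
qed

lemma dvd_diff_prod:
  fixes u v :: "'i \<Rightarrow> 'r::comm_ring_1"
  assumes "finite A" "\<And>i. i \<in> A \<Longrightarrow> d dvd u i - v i"
  shows "d dvd prod u A - prod v A"
  using assms
proof (induction A)
  case (insert x A)
  have "prod u (insert x A) - prod v (insert x A) =
      (u x - v x) * prod u A + v x * (prod u A - prod v A)"
    using insert by (simp add: algebra_simps)
  then show ?case
    using insert by (simp add: dvd_add dvd_mult dvd_mult2)
qed simp

lemma dvd_diff_power:
  fixes u v :: "'r::comm_ring_1"
  assumes "d dvd u - v"
  shows "d dvd u ^ e - v ^ e"
  using dvd_diff_prod[of "{..<e}" d "\<lambda>_. u" "\<lambda>_. v"] assms by simp

lemma Var_diff_dvd:
  fixes f :: "('v::finite, 'k::comm_ring_1) mpol"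
  shows "(Var k - Var j) dvd f - perm_act (transpose k j) f"
proof -
  have v: "(Var k - Var j :: ('v, 'k) mpol) dvd Var i - Var (transpose k j i)" for i
    using dvd_minus_iff[of "Var k - Var j :: ('v, 'k) mpol" "Var k - Var j"]
    by (auto simp: transpose_def)
  have "f - perm_act (transpose k j) f = (\<Sum>m\<in>Poly_Mapping.keys f.
      Const (Poly_Mapping.lookup f m) *
        ((\<Prod>i\<in>UNIV. Var i ^ Poly_Mapping.lookup m i) -
         (\<Prod>i\<in>UNIV. Var (transpose k j i) ^ Poly_Mapping.lookup m i)))"
    by (subst (1) mpol_expand) (simp add: perm_act_def sum_subtractf algebra_simps)
  then show ?thesis
    by (auto intro!: dvd_sum dvd_mult dvd_diff_prod dvd_diff_power v)
qed

lemma Var_inj: "(Var k :: ('v, 'k::comm_ring_1) mpol) = Var j \<longleftrightarrow> k = j"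
proof
  assume "(Var k :: ('v, 'k) mpol) = Var j"
  then have "Poly_Mapping.lookup (Var k :: ('v, 'k) mpol) (Poly_Mapping.single k 1) =
      Poly_Mapping.lookup (Var j :: ('v, 'k) mpol) (Poly_Mapping.single k 1)"
    by simp
  then have "Poly_Mapping.single j (1::nat) = Poly_Mapping.single k 1"
    by (simp add: Var_def lookup_single when_def split: if_splits)
  then have "Poly_Mapping.lookup (Poly_Mapping.single j (1::nat)) k =
      Poly_Mapping.lookup (Poly_Mapping.single k 1) k"
    by simp
  then show "k = j"
    by (simp add: lookup_single when_def split: if_splits)
qed simp

lemma divided_difference_unique:
  fixes f :: "('v::{finite,linorder}, 'k::idom) mpol"
  assumes "k \<noteq> j" "(Var k - Var j) * g = f - perm_act (transpose k j) f"
  shows "divided_difference k j f = g"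
  unfolding divided_difference_def
proof (rule the_equality)
  fix h assume "(Var k - Var j) * h = f - perm_act (transpose k j) f"
  then have "(Var k - Var j) * h = (Var k - Var j) * g"
    using assms by simp
  moreover have "(Var k - Var j :: ('v, 'k) mpol) \<noteq> 0"
    using assms(1) Var_inj[of k j] by auto
  ultimately show "h = g"
    by (metis mult_left_cancel)
qed (rule assms(2))

lemma divided_difference_eq:
  fixes f :: "('v::{finite,linorder}, 'k::idom) mpol"
  assumes "k \<noteq> j"
  shows "(Var k - Var j) * divided_difference k j f = f - perm_act (transpose k j) f"
proof -
  obtain g where "f - perm_act (transpose k j) f = (Var k - Var j) * g"
    using Var_diff_dvd[of k j f] by (auto elim: dvdE)
  then show ?thesis
    using divided_difference_unique[OF assms, of g f] by simp
qed

lemma dunkl_add: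
  fixes f g :: "('v::{finite,linorder}, 'k::idom) mpol"
  shows "dunkl c k (f + g) = dunkl c k f + dunkl c k g"
proof -
  have "divided_difference k j (f + g) = divided_difference k j f + divided_difference k j g"
    if "k \<noteq> j" for j
    using that
    by (intro divided_difference_unique)
      (simp_all add: ring_distribs(1) divided_difference_eq perm_act_add)
  then have "(\<Sum>j\<in>UNIV - {k}. divided_difference k j (f + g)) =
      (\<Sum>j\<in>UNIV - {k}. divided_difference k j f + divided_difference k j g)"
    by (intro sum.cong) auto
  then show ?thesis
    by (simp add: dunkl_def partial_add sum.distrib algebra_simps)
qed

lemma mdeg_eq_0: "mdeg m = 0 \<longleftrightarrow> m = 0"
  by (auto simp: mdeg_def intro!: poly_mapping_eqI)

lemma proper_imp_no_constant_term:
  fixes f :: "('v::{finite,linorder}, 'k::field) mpol"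
  assumes I: "graded_submodule c I" "I \<noteq> UNIV" and "f \<in> I"
  shows "Poly_Mapping.lookup f 0 = 0"
proof (rule ccontr)
  let ?a = "Poly_Mapping.lookup f 0"
  assume a: "?a \<noteq> 0"
  then have "{m. m \<in> Poly_Mapping.keys f \<and> mdeg m = 0} = {0}"
    by (auto simp: mdeg_eq_0 in_keys_iff)
  then have "hom_component 0 f = Const ?a"
    by (simp add: hom_component_def Const_def)
  moreover have "hom_component 0 f \<in> I"
    using I \<open>f \<in> I\<close> by (auto simp: graded_submodule_def)
  ultimately have *: "g * Const ?a \<in> I" for g
    using I by (auto simp: graded_submodule_def)
  have "g \<in> I" for g
    using *[of "g * Const (inverse ?a)"] a
    by (simp add: Const_def mult.assoc mult_single)
  then show False
    using I by auto
qed

inductive_set submodule_sum ::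
    "'k \<Rightarrow> ('v::{finite,linorder}, 'k::field) mpol set" for c
  where
    "0 \<in> submodule_sum c"
  | "graded_submodule c I \<Longrightarrow> I \<noteq> UNIV \<Longrightarrow> f \<in> I \<Longrightarrow> g \<in> submodule_sum c
      \<Longrightarrow> f + g \<in> submodule_sum c"

lemma submodule_sum_member:
  "graded_submodule c I \<Longrightarrow> I \<noteq> UNIV \<Longrightarrow> f \<in> I \<Longrightarrow> f \<in> submodule_sum c"
  using submodule_sum.intros(2)[of c I f 0] submodule_sum.intros(1)[of c] by simp

lemma submodule_sum_add:
  "f \<in> submodule_sum c \<Longrightarrow> g \<in> submodule_sum c \<Longrightarrow> f + g \<in> submodule_sum c"
  by (induction rule: submodule_sum.induct) (auto simp: add.assoc intro: submodule_sum.intros)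

lemma submodule_sum_closed:
  assumes add: "\<And>f g. T (f + g) = T f + T g"
    and closed: "\<And>I f. graded_submodule c I \<Longrightarrow> f \<in> I \<Longrightarrow> T f \<in> I"
    and "f \<in> submodule_sum c"
  shows "T f \<in> submodule_sum c"
  using assms(3)
proof induction
  case 1
  have "T 0 = 0"
    using add[of 0 0] by (simp only: add_0_right add_cancel_right_right)
  then show ?case
    by (simp add: submodule_sum.intros)
next
  case (2 I f g)
  then show ?case
    using closed[of I f] by (auto simp: add intro: submodule_sum.intros)
qed

lemma submodule_sum_graded_submodule: "graded_submodule c (submodule_sum c :: ('v::{finite,linorder}, 'k::field) mpol set)"
  unfolding graded_submodule_def
proof (intro conjI ballI allI impI)
  show "0 \<in> (submodule_sum c :: ('v, 'k) mpol set)"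
    by (rule submodule_sum.intros)
next
  fix f g :: "('v, 'k) mpol" assume "f \<in> submodule_sum c" "g \<in> submodule_sum c"
  then show "f + g \<in> submodule_sum c"
    by (rule submodule_sum_add)
next
  fix f g :: "('v, 'k) mpol" assume "f \<in> submodule_sum c"
  then show "g * f \<in> submodule_sum c"
    by (intro submodule_sum_closed[where T = "\<lambda>f. g * f"])
      (auto simp: ring_distribs graded_submodule_def)
next
  fix f :: "('v, 'k) mpol" and \<sigma> :: "'v \<Rightarrow> 'v" assume "f \<in> submodule_sum c" "bij \<sigma>"
  then show "perm_act \<sigma> f \<in> submodule_sum c"
    by (intro submodule_sum_closed[where T = "perm_act \<sigma>"])
      (auto simp: perm_act_add graded_submodule_def)
next
  fix f :: "('v, 'k) mpol" and k assume "f \<in> submodule_sum c"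
  then show "dunkl c k f \<in> submodule_sum c"
    by (intro submodule_sum_closed[where T = "dunkl c k"])
      (auto simp: dunkl_add graded_submodule_def)
next
  fix f :: "('v, 'k) mpol" and d assume "f \<in> submodule_sum c"
  then show "hom_component d f \<in> submodule_sum c"
    by (intro submodule_sum_closed[where T = "hom_component d"])
      (auto simp: hom_component_add graded_submodule_def)
qed

lemma submodule_sum_proper:
  "(submodule_sum c :: ('v::{finite,linorder}, 'k::field) mpol set) \<noteq> UNIV"
proof
  assume "(submodule_sum c :: ('v, 'k) mpol set) = UNIV"
  moreover have "Poly_Mapping.lookup f 0 = 0" if "f \<in> submodule_sum c" for f :: "('v, 'k) mpol"
    using that
    by induction (auto simp: lookup_add proper_imp_no_constant_term)
  ultimately have "Poly_Mapping.lookup (1 :: ('v, 'k) mpol) 0 = 0"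
    by auto
  then show False
    by simp
qed

lemma maximal_submodule_eq:
  "maximal_submodule c = (submodule_sum c :: ('v::{finite,linorder}, 'k::field) mpol set)"
  unfolding maximal_submodule_def
proof (rule Greatest_equality)
  show "graded_submodule c (submodule_sum c :: ('v, 'k) mpol set) \<and>
      (submodule_sum c :: ('v, 'k) mpol set) \<noteq> UNIV"
    using submodule_sum_graded_submodule submodule_sum_proper by blast
next
  fix I :: "('v, 'k) mpol set"
  assume "graded_submodule c I \<and> I \<noteq> UNIV"
  then show "I \<subseteq> submodule_sum c"
    using submodule_sum_member by blast
qed

lemma maximal_submodule_greatest:
  fixes c :: "'k::field"
  defines "J \<equiv> maximal_submodule c :: ('v::{finite,linorder}, 'k) mpol set"
  shows "graded_submodule c J" "J \<noteq> UNIV"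
    and "\<And>I. graded_submodule c I \<Longrightarrow> I \<noteq> UNIV \<Longrightarrow> I \<subseteq> J"
  unfolding J_def maximal_submodule_eq
  using submodule_sum_graded_submodule submodule_sum_proper submodule_sum_member by blast+

end

theory Submission
  imports Defs
begin

text \<open>
  Write \<open>p\<^sub>e = \<Sum>\<^sub>i x\<^sub>i\<^sup>e\<close> and \<open>q\<^sub>e = \<Sum>\<^sub>i a\<^sub>i x\<^sub>i\<^sup>e\<close>. In characteristic three, Newton's identities give
  \<open>\<Sum>\<^bsub>i<j<k\<^esub> (a\<^sub>i + a\<^sub>j + a\<^sub>k) x\<^sub>i x\<^sub>j x\<^sub>k = q\<^sub>1 p\<^sub>2 - q\<^sub>1 p\<^sub>1\<^sup>2 - q\<^sub>2 p\<^sub>1 + q\<^sub>3\<close>, and the bracket multiplied by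
  \<open>c\<^sup>2\<close> collapses, so that \<open>F = q\<^sub>3 - c (q\<^sub>2 p\<^sub>1 - q\<^sub>1 p\<^sub>2) - c\<^sup>2 q\<^sub>1 p\<^sub>1\<^sup>2\<close>. Only the \<open>q\<^sub>e\<close> change under the
  transposition of \<open>x\<^sub>k\<close> and \<open>x\<^sub>j\<close>, and they change by \<open>(a\<^sub>k - a\<^sub>j) (x\<^sub>k\<^sup>e - x\<^sub>j\<^sup>e)\<close>; hence every divided
  difference is explicit, and since \<open>n = 0\<close> and \<open>\<Sum>\<^sub>i a\<^sub>i = 0\<close> in the ground field, all terms of
  \<open>D\<^sub>k F\<close> cancel except \<open>- 3 c\<^sup>2 q\<^sub>1 p\<^sub>1 = 0\<close>. Permuting the variables only permutes the \<open>a\<^sub>i\<close>, so by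
  the product formula for Dunkl operators the ideal generated by these polynomials, for all
  \<open>a\<close> with sum zero, is a proper graded submodule.
\<close>

section \<open>The operators on products\<close>

text \<open>Finite support makes every polynomial a sum of single terms, so additive statements need
  only be checked on monomials.\<close>

lemma mpol_induct [case_names single add]:
  fixes f :: "'m \<Rightarrow>\<^sub>0 'b::comm_monoid_add"
  assumes single: "\<And>m a. P (Poly_Mapping.single m a)"
    and add: "\<And>f g. P f \<Longrightarrow> P g \<Longrightarrow> P (f + g)"
  shows "P f"
proof -
  have "P (\<Sum>m\<in>A. Poly_Mapping.single m (Poly_Mapping.lookup f m))" if "finite A" for A
    using that
  proof induction
    case empty
    then show ?case
      using single[of undefined 0] by simp
  qed (simp add: single add)
  from this[of "Poly_Mapping.keys f"] show ?thesis
    by (simp add: sum_single_lookup)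
qed

lemma Const_1: "Const 1 = 1"
  by (simp add: Const_def)

lemma Const_mult: "Const (a * b) = (Const a * Const b :: ('v, 'k::comm_ring_1) mpol)"
  by (simp add: Const_def mult_single)

lemma Const_diff: "Const (a - b) = (Const a - Const b :: ('v, 'k::comm_ring_1) mpol)"
  by (simp add: Const_def single_diff)

lemma Const_sum: "Const (\<Sum>i\<in>A. f i) = (\<Sum>i\<in>A. Const (f i))"
  by (induction A rule: infinite_finite_induct) (simp_all add: Const_0 Const_add)

lemma Const_of_nat: "Const (of_nat m) = (of_nat m :: ('v, 'k::comm_ring_1) mpol)"
  by (induction m) (simp_all add: Const_0 Const_1 Const_add)

lemma partial_single:
  "partial k (Poly_Mapping.single m a) =
    Poly_Mapping.single (m - Poly_Mapping.single k 1) (of_nat (Poly_Mapping.lookup m k) * a)"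
  by (cases "a = 0") (simp_all add: partial_def)

lemma perm_act_single:
  "perm_act \<sigma> (Poly_Mapping.single m a) =
    Const a * (\<Prod>i\<in>UNIV. Var (\<sigma> i) ^ Poly_Mapping.lookup m i)"
  by (cases "a = 0") (simp_all add: perm_act_def Const_0)

text \<open>Both sides are additive in \<open>f\<close> and in \<open>g\<close>, which leaves two
  single terms, where the exponents of x_k add.\<close>

lemma partial_mult: "partial k (f * g) = partial k f * g + f * partial k g"
proof (induction f rule: mpol_induct)
  case (single m a)
  show ?case
  proof (induction g rule: mpol_induct)
    case (single m' b)
    \<comment> \<open>Truncated subtraction is harmless when x_k occurs in \<open>u\<close>; when it
      does not, the terms in \<open>1\<close> and \<open>2\<close> have coefficient zero.\<close>
    have shift: "u - Poly_Mapping.single k 1 + v = u + v - Poly_Mapping.single k 1"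
      if "Poly_Mapping.lookup u k \<noteq> 0" for u v :: "'a \<Rightarrow>\<^sub>0 nat"
      using that
      by (intro poly_mapping_eqI) (auto simp: lookup_add lookup_minus lookup_single when_def)
    have 1: "Poly_Mapping.single (m - Poly_Mapping.single k 1 + m')
          (of_nat (Poly_Mapping.lookup m k) * a * b) =
        Poly_Mapping.single (m + m' - Poly_Mapping.single k 1)
          (of_nat (Poly_Mapping.lookup m k) * a * b)"
      by (cases "Poly_Mapping.lookup m k = 0") (simp_all add: shift del: One_nat_def)
    have 2: "Poly_Mapping.single (m + (m' - Poly_Mapping.single k 1))
          (a * (of_nat (Poly_Mapping.lookup m' k) * b)) =
        Poly_Mapping.single (m + m' - Poly_Mapping.single k 1)
          (a * (of_nat (Poly_Mapping.lookup m' k) * b))"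
      using shift[of m' m]
      by (cases "Poly_Mapping.lookup m' k = 0") (simp_all add: add.commute del: One_nat_def)
    show ?case
      unfolding partial_single mult_single 1 2
      by (simp add: single_add[symmetric] lookup_add algebra_simps)
  qed (simp add: partial_add algebra_simps)
qed (simp add: partial_add algebra_simps)

lemma perm_act_mult: "perm_act \<sigma> (f * g) = perm_act \<sigma> f * perm_act \<sigma> g"
proof (induction f rule: mpol_induct)
  case (single m a)
  show ?case
  proof (induction g rule: mpol_induct)
    case (single m' b)
    show ?case
      by (simp add: mult_single perm_act_single lookup_add power_add prod.distrib Const_mult
          algebra_simps)
  qed (simp add: perm_act_add algebra_simps)
qed (simp add: perm_act_add algebra_simps)

lemma partial_Const: "partial k (Const a) = 0"
  by (simp add: Const_def partial_single)

lemma partial_Var: "partial k (Var i) = (if i = k then 1 else 0)"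
  by (simp add: Var_def partial_single lookup_single when_def)

lemma partial_0: "partial k 0 = 0"
  by (simp add: partial_def)

lemma partial_sum: "partial k (\<Sum>i\<in>A. f i) = (\<Sum>i\<in>A. partial k (f i))"
  by (induction A rule: infinite_finite_induct) (simp_all add: partial_0 partial_add)

lemma partial_diff: "partial k (f - g) = partial k f - partial k g"
  using partial_add[of k "f - g" g] by (simp add: algebra_simps)

lemma perm_act_Const: "perm_act \<sigma> (Const a) = Const a"
  by (simp add: Const_def perm_act_single)

lemma perm_act_Var: "perm_act \<sigma> (Var i) = Var (\<sigma> i)"
proof -
  have "(\<Prod>j\<in>UNIV. Var (\<sigma> j) ^ Poly_Mapping.lookup (Poly_Mapping.single i 1) j) =
      (\<Prod>j\<in>UNIV. if j = i then Var (\<sigma> j) else 1 :: ('a, 'b) mpol)"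
    by (rule prod.cong) (auto simp: lookup_single when_def)
  then show ?thesis
    by (simp add: Var_def[of i] perm_act_single Const_1)
qed

lemma perm_act_0: "perm_act \<sigma> 0 = 0"
  by (simp add: perm_act_def)

lemma perm_act_sum: "perm_act \<sigma> (\<Sum>i\<in>A. f i) = (\<Sum>i\<in>A. perm_act \<sigma> (f i))"
  by (induction A rule: infinite_finite_induct) (simp_all add: perm_act_0 perm_act_add)

lemma perm_act_diff: "perm_act \<sigma> (f - g) = perm_act \<sigma> f - perm_act \<sigma> g"
  using perm_act_add[of \<sigma> "f - g" g] by (simp add: algebra_simps)

lemma perm_act_power: "perm_act \<sigma> (f ^ e) = perm_act \<sigma> f ^ e"
  by (induction e) (simp_all add: perm_act_mult perm_act_Const[of _ 1, unfolded Const_1])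

text \<open>For a transposition s, f g - s(f) s(g) = f (g - s(g)) + (f - s(f)) s(g). Hence if
  \<open>dunkl c k\<close> kills \<open>g\<close>, it sends \<open>f * g\<close> to a combination of
  \<open>g\<close> and its transposed copies.\<close>

lemma dunkl_mult:
  fixes f g :: "('v::{finite,linorder}, 'k::idom) mpol"
  shows "dunkl c k (f * g) = partial k f * g + f * dunkl c k g
    - Const c * (\<Sum>j\<in>UNIV - {k}. divided_difference k j f * perm_act (transpose k j) g)"
proof -
  have "divided_difference k j (f * g) =
      f * divided_difference k j g + divided_difference k j f * perm_act (transpose k j) g"
    if "k \<noteq> j" for j
  proof (rule divided_difference_unique[OF that])
    have "(Var k - Var j) *
        (f * divided_difference k j g + divided_difference k j f * perm_act (transpose k j) g) =
        f * ((Var k - Var j) * divided_difference k j g) +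
        ((Var k - Var j) * divided_difference k j f) * perm_act (transpose k j) g"
      by (simp add: algebra_simps)
    then show "(Var k - Var j) *
        (f * divided_difference k j g + divided_difference k j f * perm_act (transpose k j) g) =
        f * g - perm_act (transpose k j) (f * g)"
      unfolding divided_difference_eq[OF that] perm_act_mult by (simp add: algebra_simps)
  qed
  then have "(\<Sum>j\<in>UNIV - {k}. divided_difference k j (f * g)) =
      (\<Sum>j\<in>UNIV - {k}. f * divided_difference k j g
        + divided_difference k j f * perm_act (transpose k j) g)"
    by (intro sum.cong) auto
  then show ?thesis
    by (simp add: dunkl_def partial_mult sum.distrib sum_distrib_left algebra_simps)
qed

section \<open>Homogeneous singular vectors\<close>

lemma mdeg_add: "mdeg (m + m') = mdeg m + mdeg m'"
  by (simp add: mdeg_def lookup_add sum.distrib)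

lemma homogeneous_0: "homogeneous d 0"
  by (simp add: homogeneous_def)

lemma homogeneous_single: "mdeg m = d \<Longrightarrow> homogeneous d (Poly_Mapping.single m a)"
  by (simp add: homogeneous_def)

lemma homogeneous_add: "homogeneous d f \<Longrightarrow> homogeneous d g \<Longrightarrow> homogeneous d (f + g)"
  using Poly_Mapping.keys_add[of f g] by (auto simp: homogeneous_def)

lemma homogeneous_diff:
  fixes f g :: "('v::finite, 'k::comm_ring_1) mpol"
  shows "homogeneous d f \<Longrightarrow> homogeneous d g \<Longrightarrow> homogeneous d (f - g)"
  using homogeneous_add[of d f "- g"] by (simp add: homogeneous_def)

lemma homogeneous_sum:
  "(\<And>i. i \<in> A \<Longrightarrow> homogeneous d (f i)) \<Longrightarrow> homogeneous d (\<Sum>i\<in>A. f i)"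
  by (induction A rule: infinite_finite_induct) (simp_all add: homogeneous_0 homogeneous_add)

lemma homogeneous_mult:
  fixes f g :: "('v::finite, 'k::comm_ring_1) mpol"
  assumes "homogeneous d f" "homogeneous e g"
  shows "homogeneous (d + e) (f * g)"
  unfolding homogeneous_def
proof
  fix m assume "m \<in> Poly_Mapping.keys (f * g)"
  then obtain u v where "m = u + v" "u \<in> Poly_Mapping.keys f" "v \<in> Poly_Mapping.keys g"
    using Poly_Mapping.keys_mult[of f g] by auto
  then show "mdeg m = d + e"
    using assms by (simp add: homogeneous_def mdeg_add)
qed

lemma homogeneous_Const: "homogeneous 0 (Const a)"
  unfolding Const_def by (rule homogeneous_single) (simp add: mdeg_def)

lemma homogeneous_Var: "homogeneous 1 (Var i)"
  unfolding Var_def by (rule homogeneous_single) (simp add: mdeg_def lookup_single when_def)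

lemma homogeneous_power:
  fixes f :: "('v::finite, 'k::comm_ring_1) mpol"
  assumes "homogeneous d f"
  shows "homogeneous (e * d) (f ^ e)"
proof (induction e)
  case 0
  then show ?case
    using homogeneous_Const[of "1 :: 'k"] by (simp add: Const_1)
qed (simp add: assms homogeneous_mult)

lemma hom_component_homogeneous:
  assumes "homogeneous d f"
  shows "hom_component e f = (if e = d then f else 0)"
proof (cases "e = d")
  case True
  then have "{m. m \<in> Poly_Mapping.keys f \<and> mdeg m = e} = Poly_Mapping.keys f"
    using assms by (auto simp: homogeneous_def)
  then show ?thesis
    using True by (simp add: hom_component_def sum_single_lookup)
next
  case False
  then have "{m. m \<in> Poly_Mapping.keys f \<and> mdeg m = e} = {}"
    using assms by (auto simp: homogeneous_def)
  with False show ?thesis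
    unfolding hom_component_def by (simp only: sum.empty if_False)
qed

text \<open>Exponent vectors of the product are sums of one from each factor, and the one from
  \<open>g\<close> has positive degree. This keeps the generated ideal proper.\<close>

lemma lookup_mult_homogeneous_0:
  fixes f g :: "('v::finite, 'k::comm_ring_1) mpol"
  assumes "homogeneous d g" "d > 0"
  shows "Poly_Mapping.lookup (f * g) 0 = 0"
proof (rule ccontr)
  assume "Poly_Mapping.lookup (f * g) 0 \<noteq> 0"
  then have "0 \<in> Poly_Mapping.keys (f * g)"
    by (simp add: in_keys_iff)
  then obtain u v where "0 = u + v" "v \<in> Poly_Mapping.keys g"
    using Poly_Mapping.keys_mult[of f g] by auto
  then show False
    using assms mdeg_add[of u v] mdeg_eq_0[of "0 :: 'v \<Rightarrow>\<^sub>0 nat"] by (simp add: homogeneous_def)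
qed

text \<open>The ring as a module over itself: \<open>span\<close> becomes the generated
  ideal.\<close>

lemma module_times: "module ((*) :: 'a::comm_ring_1 \<Rightarrow> _)"
  by unfold_locales (simp_all add: algebra_simps)

lemma singular_subset_maximal_submodule:
  fixes c :: "'k::field" and S :: "('v::{finite,linorder}, 'k) mpol set"
  assumes homogeneous: "\<And>f. f \<in> S \<Longrightarrow> homogeneous d f" and d: "d > 0"
    and perm: "\<And>f \<sigma>. f \<in> S \<Longrightarrow> bij \<sigma> \<Longrightarrow> perm_act \<sigma> f \<in> S"
    and singular: "\<And>f k. f \<in> S \<Longrightarrow> dunkl c k f = 0"
  shows "S \<subseteq> maximal_submodule c"
proof -
  interpret ideal: module "(*) :: ('v, 'k) mpol \<Rightarrow> _"
    by (rule module_times)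
  let ?I = "ideal.span S"
  \<comment> \<open>Permutations, Dunkl operators and homogeneous components are all additive, so
    stability need only be tested on multiples \<open>f * g\<close> of a generator
    \<open>g\<close>.\<close>
  have closed: "T f \<in> ?I"
    if f: "f \<in> ?I" and add: "\<And>f g. T (f + g) = T f + T g"
      and gen: "\<And>f g. g \<in> S \<Longrightarrow> T (f * g) \<in> ?I"
    for T :: "('v, 'k) mpol \<Rightarrow> ('v, 'k) mpol" and f
    using f
  proof (induction rule: ideal.span_induct_alt)
    case base
    have "T 0 = 0"
      using add[of 0 0] by (simp only: add_0_right add_cancel_right_right)
    then show ?case
      by (simp add: ideal.span_zero)
  next
    case (step u x y)
    then show ?case
      by (simp add: add gen ideal.span_add)
  qed
  have member: "f * g \<in> ?I" if "g \<in> S" for f g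
    using that by (intro ideal.span_scale ideal.span_base)
  have "graded_submodule c ?I"
    unfolding graded_submodule_def
  proof (intro conjI ballI allI impI)
    fix f :: "('v, 'k) mpol" and \<sigma> :: "'v \<Rightarrow> 'v" assume f: "f \<in> ?I" and \<sigma>: "bij \<sigma>"
    show "perm_act \<sigma> f \<in> ?I"
      using f
      by (rule closed[where T = "perm_act \<sigma>"]) (simp_all add: perm_act_add perm_act_mult member perm \<sigma>)
  next
    fix f :: "('v, 'k) mpol" and k assume "f \<in> ?I"
    then show "dunkl c k f \<in> ?I"
    proof (rule closed[where T = "dunkl c k"])
      fix f g :: "('v, 'k) mpol" assume g: "g \<in> S"
      then have "perm_act (transpose k j) g \<in> S" for j
        using perm by simp
      then show "dunkl c k (f * g) \<in> ?I"
        unfolding dunkl_mult singular[OF g] mult_zero_right add_0_right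
        by (intro ideal.span_diff ideal.span_scale[where c = "Const c"] ideal.span_sum member g)
    qed (rule dunkl_add)
  next
    fix f :: "('v, 'k) mpol" and e assume "f \<in> ?I"
    then show "hom_component e f \<in> ?I"
    proof (rule closed[where T = "hom_component e"])
      fix f g :: "('v, 'k) mpol" assume g: "g \<in> S"
      show "hom_component e (f * g) \<in> ?I"
      \<comment> \<open>\<open>f * g\<close> need not be homogeneous, but it is for a single term
        \<open>f\<close>, and then its components are itself and \<open>0\<close>.\<close>
      proof (induction f rule: mpol_induct)
        case (single m a)
        have "homogeneous (mdeg m + d) (Poly_Mapping.single m a * g)"
          using homogeneous[OF g] by (intro homogeneous_mult homogeneous_single) auto
        then show ?case
          using member[OF g] by (simp add: hom_component_homogeneous ideal.span_zero)
      qed (simp add: ring_distribs hom_component_add ideal.span_add)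
    qed (rule hom_component_add)
  qed (auto intro: ideal.span_zero ideal.span_add ideal.span_scale)
  moreover have "?I \<noteq> UNIV"
  proof
    assume "?I = UNIV"
    moreover have "Poly_Mapping.lookup f 0 = 0" if "f \<in> ?I" for f
      using that
      by (induction rule: ideal.span_induct_alt)
        (simp_all add: lookup_add lookup_mult_homogeneous_0[OF homogeneous d])
    ultimately have "Poly_Mapping.lookup (1 :: ('v, 'k) mpol) 0 = 0"
      by auto
    then show False
      by simp
  qed
  ultimately have "?I \<subseteq> maximal_submodule c"
    by (rule maximal_submodule_greatest)
  then show ?thesis
    using ideal.span_superset[of S] by blast
qed

section \<open>The cubic singular vectors in characteristic three\<close>

text \<open>In characteristic three 1/2 = -1, which turns (p_1^2 - p_2)/2 into p_2 - p_1^2. The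
  formulas are proved together by adjoining a new maximum \<open>m\<close>: the triples containing
  \<open>m\<close> reduce to the two sums over pairs.\<close>

lemma sum_ordered_tuples_char_3:
  fixes x a :: "'v::linorder \<Rightarrow> 'r::comm_ring_1"
  assumes "finite A" and 3: "(3 :: 'r) = 0"
  defines "p \<equiv> \<lambda>e. \<Sum>i\<in>A. x i ^ e" and "q \<equiv> \<lambda>e. \<Sum>i\<in>A. a i * x i ^ e"
  shows "(\<Sum>i\<in>A. \<Sum>j | j \<in> A \<and> j < i. x j * x i) = p 2 - p 1 ^ 2" (is ?E)
    and "(\<Sum>i\<in>A. \<Sum>j | j \<in> A \<and> j < i. (a j + a i) * x j * x i) = q 1 * p 1 - q 2" (is ?S)
    and "(\<Sum>i\<in>A. \<Sum>j | j \<in> A \<and> j < i. \<Sum>k | k \<in> A \<and> k < j. (a k + a j + a i) * x k * x j * x i)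
      = q 1 * p 2 - q 1 * p 1 ^ 2 - q 2 * p 1 + q 3" (is ?T)
proof -
  have 2: "2 * y = - y" for y :: 'r
  proof -
    have "2 * y = 3 * y - y"
      by simp
    then show ?thesis
      by (simp add: 3)
  qed
  have "?E \<and> ?S \<and> ?T"
    unfolding p_def q_def using assms(1)
  proof (induction A rule: finite_linorder_max_induct)
    case (insert m A)
    let ?p = "\<lambda>e. \<Sum>i\<in>A. x i ^ e" and ?q = "\<lambda>e. \<Sum>i\<in>A. a i * x i ^ e"
    have m: "m \<notin> A" "\<And>i. i \<in> A \<Longrightarrow> i < m"
      using insert by auto
    have below: "{j \<in> insert m A. j < i} = {j \<in> A. j < i}" if "i \<in> A" for i
      using m(2)[OF that] by auto
    have max: "{j \<in> insert m A. j < m} = A"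
      using m by auto
    have below2: "(\<Sum>j | j \<in> insert m A \<and> j < i. g j) = (\<Sum>j | j \<in> A \<and> j < i. g j)"
      if "i \<in> A" for i and g :: "_ \<Rightarrow> 'r"
      using below[OF that] by simp
    \<comment> \<open>The larger index is either \<open>m\<close>, with all of \<open>A\<close>
      below it, or lies in \<open>A\<close>, where \<open>m\<close> is never below it.\<close>
    have split: "(\<Sum>i\<in>insert m A. \<Sum>j | j \<in> insert m A \<and> j < i. g i j) =
        (\<Sum>j\<in>A. g m j) + (\<Sum>i\<in>A. \<Sum>j | j \<in> A \<and> j < i. g i j)" for g :: "_ \<Rightarrow> _ \<Rightarrow> 'r"
    proof -
      have "(\<Sum>i\<in>A. \<Sum>j | j \<in> insert m A \<and> j < i. g i j) = (\<Sum>i\<in>A. \<Sum>j | j \<in> A \<and> j < i. g i j)"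
        by (intro sum.cong below2 refl)
      then show ?thesis
        by (simp only: sum.insert[OF insert(1) m(1)] max)
    qed
    have E: "(\<Sum>i\<in>insert m A. \<Sum>j | j \<in> insert m A \<and> j < i. x j * x i) =
        x m * ?p 1 + (?p 2 - ?p 1 ^ 2)"
      unfolding split using insert.IH by (simp add: sum_distrib_left mult.commute)
    have S: "(\<Sum>i\<in>insert m A. \<Sum>j | j \<in> insert m A \<and> j < i. (a j + a i) * x j * x i) =
        x m * (?q 1 + a m * ?p 1) + (?q 1 * ?p 1 - ?q 2)"
      unfolding split using insert.IH
      by (simp add: sum_distrib_left sum_distrib_right sum.distrib algebra_simps)
    have "(\<Sum>i\<in>insert m A. \<Sum>j | j \<in> insert m A \<and> j < i. \<Sum>k | k \<in> insert m A \<and> k < j.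
          (a k + a j + a i) * x k * x j * x i) =
        (\<Sum>j\<in>A. \<Sum>k | k \<in> A \<and> k < j. (a k + a j + a m) * x k * x j * x m) +
        (\<Sum>i\<in>A. \<Sum>j | j \<in> A \<and> j < i. \<Sum>k | k \<in> A \<and> k < j. (a k + a j + a i) * x k * x j * x i)"
      unfolding split by (intro arg_cong2[where f = "(+)"] sum.cong below2 refl) auto
    \<comment> \<open>Splitting off \<open>a m\<close> from the weight produces the pair sums of
      \<open>?S\<close> and \<open>?E\<close>.\<close>
    also have "(\<Sum>j\<in>A. \<Sum>k | k \<in> A \<and> k < j. (a k + a j + a m) * x k * x j * x m) =
        x m * ((\<Sum>j\<in>A. \<Sum>k | k \<in> A \<and> k < j. (a k + a j) * x k * x j) +
          a m * (\<Sum>j\<in>A. \<Sum>k | k \<in> A \<and> k < j. x k * x j))"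
      by (simp add: sum_distrib_left sum.distrib algebra_simps)
    finally have T: "(\<Sum>i\<in>insert m A. \<Sum>j | j \<in> insert m A \<and> j < i. \<Sum>k | k \<in> insert m A \<and> k < j.
          (a k + a j + a i) * x k * x j * x i) =
        x m * (?q 1 * ?p 1 - ?q 2 + a m * (?p 2 - ?p 1 ^ 2)) +
        (?q 1 * ?p 2 - ?q 1 * ?p 1 ^ 2 - ?q 2 * ?p 1 + ?q 3)"
      using insert.IH by simp
    show ?case
      unfolding E S T using insert(1) m(1)
      by (simp add: power2_eq_square power3_eq_cube algebra_simps 2 3)
  qed simp
  then show ?E ?S ?T
    by auto
qed

text \<open>Puts the largest index outermost, as in the formulas for ordered tuples.\<close>

lemma sum_ordered_triples:
  fixes g :: "'v::{finite,linorder} \<Rightarrow> 'v \<Rightarrow> 'v \<Rightarrow> 'r::comm_monoid_add"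
  shows "(\<Sum>(i, j, k) | i < j \<and> j < k. g i j k) = (\<Sum>k\<in>UNIV. \<Sum>j | j < k. \<Sum>i | i < j. g i j k)"
proof -
  have "(\<Sum>k\<in>UNIV. \<Sum>j | j < k. \<Sum>i | i < j. g i j k) =
      (\<Sum>(k, j, i)\<in>(SIGMA k:UNIV. SIGMA j:{j. j < k}. {i. i < j}). g i j k)"
    by (simp add: sum.Sigma)
  also have "\<dots> = (\<Sum>(i, j, k) | i < j \<and> j < k. g i j k)"
    by (rule sum.reindex_bij_witness[of _ "\<lambda>(i, j, k). (k, j, i)" "\<lambda>(k, j, i). (i, j, k)"]) auto
  finally show ?thesis ..
qed

section \<open>Weighted power sums and the action of the operators on them\<close>

lemma sum_transpose:
  fixes f g :: "'v::finite \<Rightarrow> 'r::comm_ring_1"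
  assumes "k \<noteq> j"
  shows "(\<Sum>i\<in>UNIV. f (transpose k j i) * g i) = (\<Sum>i\<in>UNIV. f i * g i) - (f k - f j) * (g k - g j)"
proof -
  have "(\<Sum>i\<in>UNIV. (f i - f (transpose k j i)) * g i) =
      (\<Sum>i\<in>{k, j}. (f i - f (transpose k j i)) * g i)"
    by (rule sum.mono_neutral_right) (auto simp: transpose_def)
  also have "\<dots> = (f k - f j) * (g k - g j)"
    using assms by (simp add: algebra_simps)
  finally show ?thesis
    by (simp add: sum_subtractf algebra_simps)
qed

text \<open>One notion for both families: the weights a_i give q_e, the constant weight
  \<open>1\<close> gives p_e.\<close>

definition power_sum :: "('v \<Rightarrow> 'k) \<Rightarrow> nat \<Rightarrow> ('v::finite, 'k::comm_ring_1) mpol"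
  where "power_sum b e = (\<Sum>i\<in>UNIV. Const (b i) * Var i ^ e)"

text \<open>The collapsed form of F; \<open>cubic_singular_eq\<close> matches it with the expanded
  form when \<open>3 = 0\<close>.\<close>

definition cubic_singular :: "'k \<Rightarrow> ('v \<Rightarrow> 'k) \<Rightarrow> ('v::finite, 'k::comm_ring_1) mpol"
  where "cubic_singular c b =
    power_sum b 3
    - Const c * (power_sum b 2 * power_sum (\<lambda>_. 1) 1 - power_sum b 1 * power_sum (\<lambda>_. 1) 2)
    - Const c ^ 2 * power_sum b 1 * power_sum (\<lambda>_. 1) 1 ^ 2"

lemma three_mpol:
  assumes "(3 :: 'k::comm_ring_1) = 0"
  shows "(3 :: ('v, 'k) mpol) = 0"
  using Const_of_nat[of 3, where 'v = 'v and 'k = 'k] assms by (simp add: Const_0)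

lemma homogeneous_power_sum: "homogeneous e (power_sum b e)"
  unfolding power_sum_def
  using homogeneous_mult[OF homogeneous_Const homogeneous_power[OF homogeneous_Var]]
  by (intro homogeneous_sum) fastforce

lemma homogeneous_cubic_singular: "homogeneous 3 (cubic_singular c b)"
proof -
  let ?p = "power_sum (\<lambda>_. 1) :: nat \<Rightarrow> ('a, 'b) mpol"
  have degrees: "2 + 1 = (3 :: nat)" "1 + 2 = (3 :: nat)" "0 + 3 = (3 :: nat)"
    "2 * 0 + 1 + 2 * 1 = (3 :: nat)"
    by simp_all
  have "homogeneous (2 + 1) (power_sum b 2 * ?p 1)" "homogeneous (1 + 2) (power_sum b 1 * ?p 2)"
    by (intro homogeneous_mult homogeneous_power_sum)+
  then have "homogeneous 3 (power_sum b 2 * ?p 1 - power_sum b 1 * ?p 2)"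
    by (intro homogeneous_diff) (simp_all only: degrees)
  then have "homogeneous (0 + 3) (Const c * (power_sum b 2 * ?p 1 - power_sum b 1 * ?p 2))"
    by (intro homogeneous_mult homogeneous_Const)
  moreover have "homogeneous (2 * 0 + 1 + 2 * 1)
      (Const c ^ 2 * power_sum b 1 * power_sum (\<lambda>_. 1) 1 ^ 2)"
    by (intro homogeneous_mult homogeneous_power homogeneous_Const homogeneous_power_sum)
  ultimately show ?thesis
    unfolding cubic_singular_def
    by (intro homogeneous_diff homogeneous_power_sum)
      (simp_all only: degrees)
qed

text \<open>The substitution moves the weight \<open>b i\<close> to the variable with index
  \<open>\<sigma> i\<close>. Constant weights are unaffected.\<close>

lemma perm_act_power_sum:
  assumes "bij \<sigma>"
  shows "perm_act \<sigma> (power_sum b e) = power_sum (b \<circ> inv \<sigma>) e"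
proof -
  have "(\<Sum>i\<in>UNIV. Const (b i) * Var (\<sigma> i) ^ e) =
      (\<Sum>i\<in>UNIV. Const (b (inv \<sigma> i)) * (Var i :: ('a, 'b) mpol) ^ e)"
    by (rule sum.reindex_bij_witness[of _ "inv \<sigma>" \<sigma>])
      (use assms in \<open>auto simp: bij_is_inj bij_is_surj surj_f_inv_f\<close>)
  then show ?thesis
    by (simp add: power_sum_def perm_act_sum perm_act_mult perm_act_Const perm_act_power perm_act_Var)
qed

lemma perm_act_cubic_singular:
  assumes "bij \<sigma>"
  shows "perm_act \<sigma> (cubic_singular c b) = cubic_singular c (b \<circ> inv \<sigma>)"
  by (simp add: cubic_singular_def perm_act_diff perm_act_mult perm_act_power perm_act_Const
      perm_act_power_sum[OF assms] comp_def)

lemma power_sum_transpose: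
  assumes "k \<noteq> j"
  shows "power_sum (b \<circ> transpose k j) e =
    power_sum b e - (Const (b k) - Const (b j)) * (Var k ^ e - Var j ^ e)"
  using sum_transpose[OF assms, of "\<lambda>i. Const (b i)" "\<lambda>i. Var i ^ e"] by (simp add: power_sum_def)

lemma partial_power_sum:
  "partial k (power_sum b (Suc e)) = of_nat (Suc e) * Const (b k) * Var k ^ e"
proof -
  have power: "partial k (Var i ^ Suc e) = (if i = k then of_nat (Suc e) * Var k ^ e else 0)"
    for i and e
    by (induction e) (auto simp: partial_mult partial_Var partial_Const[of k 1, unfolded Const_1] algebra_simps)
  have "partial k (power_sum b (Suc e)) =
      (\<Sum>i\<in>UNIV. if i = k then of_nat (Suc e) * Const (b k) * Var k ^ e else 0)"
    unfolding power_sum_def partial_sum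
    by (rule sum.cong) (auto simp: partial_mult partial_Const power algebra_simps simp del: power_Suc)
  then show ?thesis
    by simp
qed

text \<open>Apart from the common factor \<open>Const (b k) - Const (b j)\<close>, dividing the
  changes of q_1, q_2, q_3 by x_k - x_j leaves 1, x_k + x_j and, by Frobenius, (x_k -
  x_j)^2.\<close>

lemma divided_difference_cubic_singular:
  fixes c :: "'k::idom" and b :: "'v::{finite,linorder} \<Rightarrow> 'k"
  assumes "k \<noteq> j" and 3: "(3 :: 'k) = 0"
  shows "divided_difference k j (cubic_singular c b) =
    (Const (b k) - Const (b j)) *
      ((Var k - Var j) ^ 2
       - Const c * ((Var k + Var j) * power_sum (\<lambda>_. 1) 1 - power_sum (\<lambda>_. 1) 2)
       - Const c ^ 2 * power_sum (\<lambda>_. 1) 1 ^ 2)" (is "_ = ?g")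
proof (rule divided_difference_unique[OF assms(1)])
  let ?x = "Var k :: ('v, 'k) mpol" and ?y = "Var j :: ('v, 'k) mpol"
  have "?x ^ 3 - ?y ^ 3 = (?x - ?y) ^ 3 + 3 * (?x * ?y * (?x - ?y))"
    by (simp add: power3_eq_cube algebra_simps)
  then have cube: "?x ^ 3 - ?y ^ 3 = (?x - ?y) ^ 3"
    by (simp add: three_mpol[OF 3])
  have perm: "perm_act (transpose k j) (cubic_singular c b) = cubic_singular c (b \<circ> transpose k j)"
    by (simp add: perm_act_cubic_singular)
  show "(?x - ?y) * ?g = cubic_singular c b - perm_act (transpose k j) (cubic_singular c b)"
    unfolding perm unfolding cubic_singular_def
      power_sum_transpose[OF assms(1), of b] cube
    by (simp add: power2_eq_square power3_eq_cube algebra_simps)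
qed

lemma dunkl_cubic_singular:
  fixes c :: "'k::idom" and b :: "'v::{finite,linorder} \<Rightarrow> 'k"
  assumes 3: "(3 :: 'k) = 0" and n: "3 dvd CARD('v)" and b: "(\<Sum>i\<in>UNIV. b i) = 0"
  shows "dunkl c k (cubic_singular c b) = 0"
proof -
  let ?A = "Const (b k) :: ('v, 'k) mpol" and ?x = "Var k :: ('v, 'k) mpol"
  let ?p = "power_sum (\<lambda>_. 1) :: nat \<Rightarrow> ('v, 'k) mpol"
  let ?q = "power_sum b :: nat \<Rightarrow> ('v, 'k) mpol"
  let ?u = "\<lambda>j. ?A - Const (b j)"
  have three: "(3 :: ('v, 'k) mpol) = 0"
    by (rule three_mpol[OF 3])
  have s: "(\<Sum>j\<in>UNIV. ?u j * Var j ^ e) = ?A * ?p e - ?q e" for e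
    by (simp add: power_sum_def Const_1 sum_subtractf sum_distrib_left algebra_simps)
  \<comment> \<open>The \<open>?u j\<close> add up to n copies of \<open>?A\<close> minus the total
    weight: the former vanishes because 3 divides n, the latter by hypothesis.\<close>
  obtain m where "CARD('v) = 3 * m"
    using n by (auto elim: dvdE)
  then have "of_nat CARD('v) = (0 :: ('v, 'k) mpol)"
    by (simp add: three)
  moreover have "(\<Sum>j\<in>UNIV. Const (b j)) = (0 :: ('v, 'k) mpol)"
    by (simp add: Const_sum[symmetric] b Const_0)
  ultimately have s0: "(\<Sum>j\<in>UNIV. ?u j) = 0"
    by (simp add: sum_subtractf)
  have "(\<Sum>j\<in>UNIV - {k}. divided_difference k j (cubic_singular c b)) =
      (\<Sum>j\<in>UNIV - {k}. ?u j * ((?x - Var j) ^ 2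
         - Const c * ((?x + Var j) * ?p 1 - ?p 2) - Const c ^ 2 * ?p 1 ^ 2))"
    by (intro sum.cong divided_difference_cubic_singular 3) auto
  \<comment> \<open>The index \<open>k\<close> may be included since
    \<open>?u k = 0\<close>.\<close>
  also have "\<dots> = (\<Sum>j\<in>UNIV. ?u j * ((?x - Var j) ^ 2
         - Const c * ((?x + Var j) * ?p 1 - ?p 2) - Const c ^ 2 * ?p 1 ^ 2))"
    by (rule sum.mono_neutral_left) auto
  \<comment> \<open>Sorted by powers of x_j: the part free of x_j will vanish by \<open>s0\<close>,
    the rest is evaluated by \<open>s\<close>.\<close>
  also have "\<dots> = (\<Sum>j\<in>UNIV.
      ?u j * (?x ^ 2 - Const c * (?x * ?p 1 - ?p 2) - Const c ^ 2 * ?p 1 ^ 2)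
      - (?u j * Var j ^ 1) * (2 * ?x + Const c * ?p 1) + ?u j * Var j ^ 2)"
    by (rule sum.cong) (simp_all add: power2_eq_square algebra_simps)
  also have "\<dots> = (?A * ?p 2 - ?q 2) - (?A * ?p 1 - ?q 1) * (2 * ?x + Const c * ?p 1)"
    unfolding sum.distrib sum_subtractf sum_distrib_right[symmetric] s by (simp only: sum_subtractf[symmetric] s0) simp
  finally have dd: "(\<Sum>j\<in>UNIV - {k}. divided_difference k j (cubic_singular c b)) = \<dots>" .
  \<comment> \<open>Arbitrary weights \<open>b'\<close> serve both \<open>?q\<close> and
    \<open>?p\<close>.\<close>
  have d1: "partial k (power_sum b' 1) = Const (b' k)"
    and d2: "partial k (power_sum b' 2) = 2 * Const (b' k) * ?x"
    and d3: "partial k (power_sum b' 3) = 0" for b'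
    using partial_power_sum[of k b' 0] partial_power_sum[of k b' 1] partial_power_sum[of k b' 2]
    by (simp_all add: numeral_2_eq_2[symmetric] three)
  have "partial k (cubic_singular c b) =
      - Const c * (2 * ?A * ?x * ?p 1 + ?q 2 - ?A * ?p 2 - ?q 1 * (2 * ?x))
      - Const c ^ 2 * (?A * ?p 1 ^ 2 + 2 * ?q 1 * ?p 1)"
    unfolding cubic_singular_def power2_eq_square partial_diff partial_mult partial_Const d1 d2 d3 Const_1
    by (simp add: algebra_simps)
  \<comment> \<open>Of the coefficient -3, the derivative contributes -2 and the divided differences
    -1.\<close>
  then have "dunkl c k (cubic_singular c b) = - 3 * (Const c ^ 2 * ?q 1 * ?p 1)"
    unfolding dunkl_def dd by (simp add: power2_eq_square algebra_simps)
  then show ?thesis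
    by (simp add: three)
qed

lemma cubic_singular_in_maximal_submodule:
  fixes c :: "'k::field" and b :: "'v::{finite,linorder} \<Rightarrow> 'k"
  assumes 3: "(3 :: 'k) = 0" and n: "3 dvd CARD('v)" and b: "(\<Sum>i\<in>UNIV. b i) = 0"
  shows "cubic_singular c b \<in> maximal_submodule c"
proof -
  let ?S = "{cubic_singular c b |b :: 'v \<Rightarrow> 'k. (\<Sum>i\<in>UNIV. b i) = 0}"
  have "?S \<subseteq> maximal_submodule c"
  proof (rule singular_subset_maximal_submodule[where d = 3])
    fix f and \<sigma> :: "'v \<Rightarrow> 'v" assume "f \<in> ?S" and \<sigma>: "bij \<sigma>"
    then obtain b where b: "f = cubic_singular c b" "(\<Sum>i\<in>UNIV. b i) = 0"
      by auto
    moreover have "(\<Sum>i\<in>UNIV. (b \<circ> inv \<sigma>) i) = (\<Sum>i\<in>UNIV. b i)"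
      using sum.reindex_bij_betw[OF bij_imp_bij_inv[OF \<sigma>], of b] by (simp add: comp_def)
    ultimately show "perm_act \<sigma> f \<in> ?S"
      using perm_act_cubic_singular[OF \<sigma>, of c b] by (metis (mono_tags, lifting) mem_Collect_eq)
  qed (auto simp: homogeneous_cubic_singular dunkl_cubic_singular[OF 3 n])
  then show ?thesis
    using b by blast
qed

text \<open>In the bracket at c^2, \<open>T\<close> plus \<open>Q\<close> minus q_3 leaves only -q_1
  p_1^2.\<close>

lemma cubic_singular_eq:
  fixes c :: "'k::comm_ring_1" and b :: "'v::{finite,linorder} \<Rightarrow> 'k"
  assumes 3: "(3 :: 'k) = 0"
  shows "(\<Sum>i\<in>UNIV. Const (b i) * Var i ^ 3)
      - Const c * (\<Sum>i\<in>UNIV. \<Sum>j\<in>UNIV. Const (b i - b j) * Var i ^ 2 * Var j)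
      + Const c ^ 2 *
        ((\<Sum>(i, j, k) | i < j \<and> j < k. Const (b i + b j + b k) * Var i * Var j * Var k)
         + (\<Sum>i\<in>UNIV. \<Sum>j\<in>UNIV. Const (b i - b j) * Var i ^ 2 * Var j)
         - (\<Sum>i\<in>UNIV. Const (b i) * Var i ^ 3)) = cubic_singular c b"
proof -
  let ?p = "power_sum (\<lambda>_. 1) :: nat \<Rightarrow> ('v, 'k) mpol"
  let ?q = "power_sum b :: nat \<Rightarrow> ('v, 'k) mpol"
  \<comment> \<open>The order \<open>?p 2 * ?q 1\<close> keeps the squared variable on the outer
    index, so the double sums agree term by term.\<close>
  have Q: "(\<Sum>i\<in>UNIV. \<Sum>j\<in>UNIV. Const (b i - b j) * Var i ^ 2 * Var j) =
      ?q 2 * ?p 1 - ?p 2 * ?q 1"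
    unfolding power_sum_def sum_product
    by (simp add: Const_1 Const_diff sum_subtractf[symmetric] algebra_simps)
  have T: "(\<Sum>(i, j, k) | i < j \<and> j < k. Const (b i + b j + b k) * Var i * Var j * Var k) =
      ?q 1 * ?p 2 - ?q 1 * ?p 1 ^ 2 - ?q 2 * ?p 1 + ?q 3"
    using sum_ordered_tuples_char_3(3)[OF finite three_mpol[OF 3],
        where A = UNIV and x = Var and a = "\<lambda>i. Const (b i)"]
    by (simp add: sum_ordered_triples Const_add power_sum_def Const_1)
  have P: "(\<Sum>i\<in>UNIV. Const (b i) * Var i ^ 3) = ?q 3"
    by (simp add: power_sum_def)
  show ?thesis
    unfolding Q T P cubic_singular_def by (simp add: algebra_simps)
qed

section \<open>Coefficients in the ground field\<close>

lemma of_F3_add: "of_F3 (u + v) = of_F3 u + of_F3 v"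
  by simp

lemma of_F3_diff: "of_F3 (u - v) = of_F3 u - of_F3 v"
  by simp

lemma of_F3_0: "of_F3 0 = 0"
  by (simp only: pCons_0_0 Zero_fract_def)

lemma of_F3_1: "of_F3 1 = 1"
  by (simp only: one_pCons[symmetric] One_fract_def)

lemma of_F3_sum: "of_F3 (\<Sum>i\<in>A. f i) = (\<Sum>i\<in>A. of_F3 (f i))"
  by (induction A rule: infinite_finite_induct)
    (simp_all only: of_F3_0 of_F3_add sum.infinite sum.empty sum.insert if_False not_False_eq_True)

text \<open>Inherited from \<open>F3\<close>, where \<open>1 + 1 + 1\<close> is computed from the
  definition of addition.\<close>

lemma three_F3c: "(3 :: F3c) = 0"
proof -
  have "(3 :: F3c) = of_F3 1 + of_F3 1 + of_F3 1"
    unfolding of_F3_1 by simp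
  also have "\<dots> = of_F3 (1 + 1 + 1)"
    by (simp only: of_F3_add)
  also have "(1 + 1 + 1 :: F3) = 0"
    by (simp only: one_finite_3_def zero_finite_3_def plus_finite_3_def finite_3.case prod.case)
  finally show ?thesis
    unfolding of_F3_0 .
qed

text \<open>The coefficientwise embedding as a relation, so that the rules below can build
  \<open>g\<close> from the shape of \<open>G\<close>.\<close>

definition extends_scalars :: "('v, F3c) mpol \<Rightarrow> ('v, F3) mpol \<Rightarrow> bool"
  where "extends_scalars G g \<longleftrightarrow> (\<forall>m. Poly_Mapping.lookup G m = of_F3 (Poly_Mapping.lookup g m))"

lemma extends_scalars_single:
  "extends_scalars (Poly_Mapping.single m (of_F3 u)) (Poly_Mapping.single m u)"
  by (auto simp only: extends_scalars_def lookup_single when_def of_F3_0 split: if_split)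

lemma extends_scalars_add:
  "extends_scalars G g \<Longrightarrow> extends_scalars H h \<Longrightarrow> extends_scalars (G + H) (g + h)"
  by (simp add: extends_scalars_def lookup_add)

lemma extends_scalars_diff:
  "extends_scalars G g \<Longrightarrow> extends_scalars H h \<Longrightarrow> extends_scalars (G - H) (g - h)"
  by (simp add: extends_scalars_def lookup_minus)

lemma extends_scalars_0: "extends_scalars 0 0"
  by (simp only: extends_scalars_def lookup_zero of_F3_0 simp_thms)

lemma extends_scalars_sum:
  "(\<And>i. i \<in> A \<Longrightarrow> extends_scalars (G i) (g i)) \<Longrightarrow>
    extends_scalars (\<Sum>i\<in>A. G i) (\<Sum>i\<in>A. g i)"
  by (induction A rule: infinite_finite_induct)
    (simp_all only: extends_scalars_add extends_scalars_0 sum.infinite sum.empty sum.insert insert_iff simp_thms)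

lemma extends_scalars_monomial:
  "extends_scalars (Const (of_F3 u) * Poly_Mapping.single m 1) (Const u * Poly_Mapping.single m 1)"
  using extends_scalars_single[of m u] by (simp only: Const_def mult_single add_0_left mult_1_right)

text \<open>This and the next two rules cover the shapes of monomials occurring in F.\<close>

lemma extends_scalars_Var_power:
  "extends_scalars (Const (of_F3 u) * Var i ^ e) (Const u * Var i ^ e)"
  unfolding Var_power by (rule extends_scalars_monomial)

lemma extends_scalars_two_Var_powers:
  "extends_scalars (Const (of_F3 u) * Var i ^ d * Var j ^ e) (Const u * Var i ^ d * Var j ^ e)"
  unfolding Var_power mult.assoc mult_single mult_1_left by (rule extends_scalars_monomial)

lemma extends_scalars_three_Vars:
  "extends_scalars (Const (of_F3 u) * Var i * Var j * Var k) (Const u * Var i * Var j * Var k)"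
  unfolding Var_def mult.assoc mult_single mult_1_left by (rule extends_scalars_monomial)

section \<open>Expansion in powers of c\<close>

lemma lookup_Const_mult:
  "Poly_Mapping.lookup (Const a * f :: ('v, 'k::comm_ring_1) mpol) m = a * Poly_Mapping.lookup f m"
proof (induction f rule: mpol_induct)
  case (single m' b)
  show ?case
    by (simp add: Const_def mult_single lookup_single when_def)
qed (simp add: lookup_add algebra_simps)

lemma quadratic_poly_eq:
  fixes u v w :: "'a::comm_ring_1"
  shows "[:u:] - [:0, 1:] * [:v:] + [:0, 1:] * ([:0, 1:] * [:w:]) = [:u, - v, w:]"
  by simp

lemma fps_of_quadratic_poly:
  "fps_of_poly [:u, v, w:] =
    Abs_fps (\<lambda>l. if l = 0 then u else if l = 1 then v else if l = 2 then w else 0)"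
  by (rule fps_ext) (simp add: coeff_pCons numeral_2_eq_2 split: nat.split)

text \<open>Each coefficient is a polynomial in c of degree at most two, so the denominator
  \<open>1\<close> suffices and the series is read off: \<open>g0\<close>, \<open>- g1\<close>,
  \<open>g2\<close>, then zeros.\<close>

lemma has_leading_term_quadratic:
  fixes G0 :: "('v, F3c) mpol"
  assumes "extends_scalars G0 g0" "extends_scalars G1 g1" "extends_scalars G2 g2"
  shows "has_leading_term (G0 - Const c_param * G1 + Const c_param ^ 2 * G2) g0"
proof -
  let ?F = "G0 - Const c_param * G1 + Const c_param ^ 2 * G2"
  let ?g = "\<lambda>l :: nat. if l = 0 then g0 else if l = 1 then - g1 else if l = 2 then g2 else 0"
  have "c_expansion ?F ?g"
    unfolding c_expansion_def
  proof
    fix m :: "'v \<Rightarrow>\<^sub>0 nat"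
    let ?u = "Poly_Mapping.lookup g0 m" and ?v = "Poly_Mapping.lookup g1 m"
      and ?w = "Poly_Mapping.lookup g2 m"
    have "Poly_Mapping.lookup ?F m = of_F3 ?u - c_param * of_F3 ?v + c_param * (c_param * of_F3 ?w)"
      using assms unfolding power2_eq_square mult.assoc
      by (simp only: extends_scalars_def lookup_add lookup_minus lookup_Const_mult)
    also have "\<dots> =
        Fraction_Field.Fract ([:?u:] - [:0, 1:] * [:?v:] + [:0, 1:] * ([:0, 1:] * [:?w:])) 1"
      by simp
    finally have "Poly_Mapping.lookup ?F m = Fraction_Field.Fract [:?u, - ?v, ?w:] 1"
      unfolding quadratic_poly_eq .
    moreover have "(\<lambda>l. Poly_Mapping.lookup (?g l) m) =
        (\<lambda>l. if l = 0 then ?u else if l = 1 then - ?v else if l = 2 then ?w else 0)"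
      by (intro ext) (simp only: lookup_uminus lookup_zero split: if_split, blast)
    then have "fps_of_poly [:?u, - ?v, ?w:] =
        fps_of_poly 1 * Abs_fps (\<lambda>l. Poly_Mapping.lookup (?g l) m)"
      by (simp only: fps_of_quadratic_poly fps_of_poly_1 mult_1_left)
    ultimately show "\<exists>q r. r \<noteq> 0 \<and> Poly_Mapping.lookup ?F m = Fraction_Field.Fract q r \<and>
        fps_of_poly q = fps_of_poly r * Abs_fps (\<lambda>l. Poly_Mapping.lookup (?g l) m)"
      by (intro exI[of _ "[:?u, - ?v, ?w:]"] exI[of _ 1] conjI one_neq_zero)
  qed
  then show ?thesis
    unfolding has_leading_term_def by (intro exI[of _ ?g]) simp
qed

theorem proposition5p11:
  fixes a :: "'n::{finite,linorder} \<Rightarrow> F3"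
    and F :: "('n, F3c) mpol"
  assumes "3 dvd CARD('n)"
    and "(\<Sum>i\<in>UNIV. a i) = 0"
    and "F =
        (\<Sum>i\<in>UNIV. Const (of_F3 (a i)) * Var i ^ 3)
        - Const c_param * (\<Sum>i\<in>UNIV. \<Sum>j\<in>UNIV. Const (of_F3 (a i - a j)) * Var i ^ 2 * Var j)
        + Const c_param ^ 2 *
          ((\<Sum>(i, j, k) | i < j \<and> j < k.
              Const (of_F3 (a i + a j + a k)) * Var i * Var j * Var k)
           + (\<Sum>i\<in>UNIV. \<Sum>j\<in>UNIV. Const (of_F3 (a i - a j)) * Var i ^ 2 * Var j)
           - (\<Sum>i\<in>UNIV. Const (of_F3 (a i)) * Var i ^ 3))"
  shows "(\<forall>k. dunkl c_param k F = 0)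
    \<and> has_leading_term F (\<Sum>i\<in>UNIV. Const (a i) * Var i ^ 3)
    \<and> homogeneous 3 F
    \<and> F \<in> maximal_submodule c_param"
proof -
  have F: "F = cubic_singular c_param (\<lambda>i. of_F3 (a i))"
    using cubic_singular_eq[OF three_F3c, of "\<lambda>i. of_F3 (a i)" c_param]
    unfolding assms(3) by (simp only: of_F3_add of_F3_diff)
  have a: "(\<Sum>i\<in>UNIV. of_F3 (a i)) = 0"
    using assms(2) by (simp only: of_F3_sum[symmetric] of_F3_0)
  have "has_leading_term F (\<Sum>i\<in>UNIV. Const (a i) * Var i ^ 3)"
    \<comment> \<open>The expanded form is used here: each power of c multiplies an explicit sum of
      monomials with coefficients from \<open>F3\<close>, and unification finds \<open>g1\<close>
      and \<open>g2\<close>.\<close>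
    unfolding assms(3) case_prod_beta
    by (rule has_leading_term_quadratic extends_scalars_add extends_scalars_diff extends_scalars_sum
        extends_scalars_Var_power extends_scalars_two_Var_powers[where e = 1, unfolded power_one_right]
        extends_scalars_three_Vars)+
  then show ?thesis
    unfolding F
    using dunkl_cubic_singular[OF three_F3c assms(1) a] homogeneous_cubic_singular
      cubic_singular_in_maximal_submodule[OF three_F3c assms(1) a] by blast
qed

end
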